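(* Let $0<q<p<1$ and let $N(q,p)$ be the choice of $n$ that maximizes $f(n,p,q)$ (with ties going to the lower value). Then: 1. $\left\lfloor\frac{1}{2(p-q)}-\frac12\right\rfloor\le N(q,p)$; and if $p+q\neq 1$, then $\left\lfloor\frac{1}{2(p-q)}+\frac12\right\rfloor\le N(q,p)$. 2. $N(q,p)\le\left\lceil\frac{\max(1-p,\,q)}{p-q}\right\rceil$.
   Context: For an integer $n\ge 0$ and $0<q<p<1$, $$f(n,p,q)=\sum_{r\ge 0}\binom{n}{r}p^r(1-p)^{n-r}\sum_{s>r}\binom{n}{s}q^s(1-q)^{n-s},$$ the probability that, when Alice tosses a coin with heads probability $q$ and Bob a coin with heads probability $p$, each $n$ times independently, Alice gets strictly more heads than Bob. $N(q,p)$ is the value of $n$ that maximizes $f(n,p,q)$; when the maximizer is not unique (there are then two consecutive maximizers), $N(q,p)$ is the smaller one. *)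

theory Defs
  imports Complex_Main
begin

text \<open>The probability that Alice (heads probability \<open>q\<close>) gets strictly more heads than Bob
  (heads probability \<open>p\<close>) when each tosses \<open>n\<close> times.  The ranges \<open>r \<ge> 0\<close> and \<open>s > r\<close> are cut
  off at \<open>n\<close>, beyond which the binomial coefficients vanish.\<close>

definition win_prob :: "nat \<Rightarrow> real \<Rightarrow> real \<Rightarrow> real" where
  "win_prob n p q =
     (\<Sum>r\<in>{0..n}. real (n choose r) * p ^ r * (1 - p) ^ (n - r) *
        (\<Sum>s\<in>{r<..n}. real (n choose s) * q ^ s * (1 - q) ^ (n - s)))"

text \<open>For \<open>0 < q < p < 1\<close> a maximizer exists, because \<open>win_prob n p q\<close> is positive at \<open>n = 1\<close>
  and tends to \<open>0\<close>; outside that range the value may be unspecified.\<close>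

definition best_n :: "real \<Rightarrow> real \<Rightarrow> nat" where
  "best_n q p = (LEAST n. \<forall>m. win_prob m p q \<le> win_prob n p q)"

end

theory Submission
  imports Defs
begin

text \<open>
  Put \<open>d = p - q\<close>. One further toss by each player changes the outcome only when Alice is level
  and moves ahead, or when she leads by exactly one and drops back. Hence
  \<open>win_prob (n + 1) - win_prob n = q(1 - p) D - E\<close>, where \<open>D\<close> is the probability of a tie after
  \<open>n\<close> tosses and \<open>E\<close> is \<open>p(1 - q)\<close> times the probability of a lead by one
  (\<open>win_prob_Suc_diff\<close>). Everything depends on comparing the ratio \<open>r = E / D\<close> with \<open>q(1 - p)\<close>.

  With \<open>X = pq\<close> and \<open>Y = (1 - p)(1 - q)\<close>, both \<open>D\<close> and \<open>E\<close> are polynomials in \<open>X\<close> and \<open>Y\<close>.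
  The sum \<open>D\<close> is a Legendre polynomial in disguise, and Legendre's three-term recurrence
  takes the form of the two first-order recurrences \<open>diag_sum_Suc\<close> and \<open>offdiag_sum_Suc\<close>. In terms
  of the ratio they say
  \<open>(n + 2) r' = (n + 1) (2XY + (X + Y) r) / ((X + Y) + 2r)\<close>, and this allows an induction on
  \<open>n\<close> to enclose \<open>r\<close> between the positive roots of two quadratics:
  \<open>(n + 1) r\<^sup>2 + (X + Y)/2 r \<le> n X Y \<le> (n + 1) r\<^sup>2 + max X Y r\<close>
  (\<open>offdiag_sum_upper\<close>, \<open>offdiag_sum_lower\<close>), the left inequality being strict for \<open>n \<ge> 1\<close> and
  \<open>X \<noteq> Y\<close>, that is, \<open>p + q \<noteq> 1\<close>.

  The point of these quadratics is their value at \<open>r = q(1 - p)\<close>. Since \<open>X Y\<close> is the product of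
  \<open>q(1 - p)\<close> and \<open>p(1 - q)\<close>, a factor \<open>q(1 - p)\<close> cancels and linear conditions on \<open>n\<close> remain:
  the left quadratic exceeds \<open>n X Y\<close> iff \<open>(2n + 1) d < 1\<close>, and the right one is at most \<open>n X Y\<close>
  iff \<open>n d \<ge> max (1 - p) q\<close>. So \<open>win_prob\<close> increases from \<open>n\<close> to \<open>n + 1\<close> in the first case (also
  when \<open>(2n + 1) d = 1\<close>, if \<open>p + q \<noteq> 1\<close>) and does not increase in the second. Both bounds on the
  maximizer follow, as does its existence.
\<close>

section \<open>The effect of one more toss\<close>

definition binom_weight :: "nat \<Rightarrow> real \<Rightarrow> nat \<Rightarrow> real" where
  "binom_weight n x k = real (n choose k) * x ^ k * (1 - x) ^ (n - k)"

definition tail_prob :: "nat \<Rightarrow> real \<Rightarrow> nat \<Rightarrow> real" where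
  "tail_prob n x r = (\<Sum>s\<in>{r<..n}. binom_weight n x s)"

lemma binom_weight_0_Suc: "binom_weight (Suc n) x 0 = (1 - x) * binom_weight n x 0"
  by (simp add: binom_weight_def)

lemma binom_weight_eq_0: "n < k \<Longrightarrow> binom_weight n x k = 0"
  by (simp add: binom_weight_def)

lemma binom_weight_Suc_Suc:
  "binom_weight (Suc n) x (Suc k) = (1 - x) * binom_weight n x (Suc k) + x * binom_weight n x k"
proof (cases "k < n")
  case True
  then have "(1 - x) ^ (n - k) = (1 - x) * (1 - x) ^ (n - Suc k)"
    by (metis Suc_diff_Suc power_Suc)
  then show ?thesis
    by (simp add: binom_weight_def distrib_right distrib_left mult_ac)
qed (simp add: binom_weight_def binomial_eq_0)

text \<open>Conditioning on the last toss: the form of Pascal's rule that acts on expectations.\<close>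

lemma sum_binom_weight_Suc:
  "(\<Sum>k\<le>Suc n. binom_weight (Suc n) x k * g k)
     = (\<Sum>k\<le>n. binom_weight n x k * ((1 - x) * g k + x * g (Suc k)))"
proof -
  have "(\<Sum>k\<le>n. (1 - x) * binom_weight n x k * g k)
      = (\<Sum>k\<le>Suc n. (1 - x) * binom_weight n x k * g k)"
    by (simp add: binom_weight_eq_0)
  also have "\<dots> = (1 - x) * binom_weight n x 0 * g 0
      + (\<Sum>k\<le>n. (1 - x) * binom_weight n x (Suc k) * g (Suc k))"
    by (rule sum.atMost_Suc_shift)
  finally have stay: "(\<Sum>k\<le>n. (1 - x) * binom_weight n x k * g k) = \<dots>" .
  have "(\<Sum>k\<le>Suc n. binom_weight (Suc n) x k * g k)
      = (1 - x) * binom_weight n x 0 * g 0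
        + (\<Sum>k\<le>n. (1 - x) * binom_weight n x (Suc k) * g (Suc k))
        + (\<Sum>k\<le>n. x * binom_weight n x k * g (Suc k))"
    by (subst sum.atMost_Suc_shift)
       (simp add: binom_weight_0_Suc binom_weight_Suc_Suc distrib_right sum.distrib)
  also have "\<dots> = (\<Sum>k\<le>n. binom_weight n x k * ((1 - x) * g k + x * g (Suc k)))"
    unfolding stay[symmetric] sum.distrib[symmetric]
    by (intro sum.cong refl) (simp add: distrib_left mult_ac)
  finally show ?thesis .
qed

text \<open>A tail is the expectation of an indicator, so that \<open>sum_binom_weight_Suc\<close> applies to it.\<close>

lemma tail_prob_alt: "tail_prob n x r = (\<Sum>s\<le>n. binom_weight n x s * of_bool (r < s))"
proof -
  have "(\<Sum>s\<le>n. binom_weight n x s * of_bool (r < s))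
      = (\<Sum>s\<in>{r<..n}. binom_weight n x s * of_bool (r < s))"
    by (intro sum.mono_neutral_right) auto
  then show ?thesis
    by (simp add: tail_prob_def)
qed

lemma tail_prob_Suc: "tail_prob (Suc n) x r = tail_prob n x r + x * binom_weight n x r"
proof -
  have "tail_prob (Suc n) x r
      = (\<Sum>s\<le>n. binom_weight n x s * of_bool (r < s) + (if s = r then x * binom_weight n x s else 0))"
    unfolding tail_prob_alt sum_binom_weight_Suc
    by (intro sum.cong) (auto simp: of_bool_def algebra_simps)
  then show ?thesis
    by (cases "r \<le> n") (simp_all add: sum.distrib tail_prob_alt sum.delta binom_weight_eq_0)
qed

lemma tail_prob_shift: "tail_prob n x (Suc r) = tail_prob n x r - binom_weight n x (Suc r)"
proof (cases "Suc r \<le> n")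
  case True
  then have "{r<..n} = insert (Suc r) {Suc r<..n}" by auto
  then show ?thesis by (simp add: tail_prob_def)
qed (simp add: tail_prob_def binom_weight_eq_0)

text \<open>For \<open>X = p q\<close> and \<open>Y = (1 - p) (1 - q)\<close> this is the probability of a tie after \<open>n\<close> tosses:
  \<open>k\<close> is the common number of heads. As a polynomial it is \<open>(Y - X)\<^sup>n P\<^sub>n((Y + X) / (Y - X))\<close> with
  the Legendre polynomial \<open>P\<^sub>n\<close>.\<close>

definition diag_sum :: "nat \<Rightarrow> real \<Rightarrow> real \<Rightarrow> real" where
  "diag_sum n X Y = (\<Sum>k\<le>n. (real (n choose k))\<^sup>2 * X ^ k * Y ^ (n - k))"

text \<open>For the same \<open>X\<close> and \<open>Y\<close> this is the probability that Alice leads by one after \<open>n\<close> tosses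
  and loses the lead at the next one. The factor \<open>p (1 - q)\<close> for that next toss is what makes it a
  polynomial in \<open>X\<close> and \<open>Y\<close>.\<close>

definition offdiag_sum :: "nat \<Rightarrow> real \<Rightarrow> real \<Rightarrow> real" where
  "offdiag_sum n X Y =
     (\<Sum>k\<le>n. real (n choose k) * real (n choose Suc k) * X ^ Suc k * Y ^ (n - k))"

text \<open>Alice gains a win from a tie, when only she tosses heads, and loses one from a lead by one,
  when only Bob does; no other position can change sides in one toss.\<close>

lemma win_prob_Suc_diff:
  "win_prob (Suc n) p q - win_prob n p q
     = q * (1 - p) * diag_sum n (p * q) ((1 - p) * (1 - q))
       - offdiag_sum n (p * q) ((1 - p) * (1 - q))"
proof -
  have wp: "win_prob n p q = (\<Sum>r\<le>n. binom_weight n p r * tail_prob n q r)" for n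
    by (simp add: win_prob_def binom_weight_def tail_prob_def atMost_atLeast0)
  have diag: "diag_sum n (p * q) ((1 - p) * (1 - q))
      = (\<Sum>r\<le>n. binom_weight n p r * binom_weight n q r)"
    unfolding diag_sum_def binom_weight_def
    by (intro sum.cong) (simp_all only: power_mult_distrib power2_eq_square mult_ac)
  have off: "offdiag_sum n (p * q) ((1 - p) * (1 - q))
      = p * (1 - q) * (\<Sum>r\<le>n. binom_weight n p r * binom_weight n q (Suc r))"
    unfolding offdiag_sum_def sum_distrib_left
  proof (intro sum.cong refl)
    fix r
    show "real (n choose r) * real (n choose Suc r) * (p * q) ^ Suc r * ((1 - p) * (1 - q)) ^ (n - r)
        = p * (1 - q) * (binom_weight n p r * binom_weight n q (Suc r))"
    proof (cases "r < n")
      case True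
      then have "(1 - q) ^ (n - r) = (1 - q) * (1 - q) ^ (n - Suc r)"
        by (metis Suc_diff_Suc power_Suc)
      then show ?thesis
        by (simp add: binom_weight_def power_mult_distrib)
    qed (simp add: binom_weight_def)
  qed
  have "win_prob (Suc n) p q
      = (\<Sum>r\<le>n. binom_weight n p r * ((1 - p) * tail_prob (Suc n) q r + p * tail_prob (Suc n) q (Suc r)))"
    unfolding wp by (rule sum_binom_weight_Suc)
  also have "\<dots> = (\<Sum>r\<le>n. binom_weight n p r * tail_prob n q r
      + q * (1 - p) * (binom_weight n p r * binom_weight n q r)
      - p * (1 - q) * (binom_weight n p r * binom_weight n q (Suc r)))"
    unfolding tail_prob_Suc unfolding tail_prob_shift by (simp add: algebra_simps)
  finally show ?thesis
    unfolding diag off wp by (simp add: sum.distrib sum_subtractf sum_distrib_left)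
qed

section \<open>Recurrences for the tie and lead-by-one sums\<close>

text \<open>Squaring Pascal's rule \<open>C(n+1,k) = C(n,k) + C(n,k-1)\<close>; the cross term gives the
  off-diagonal sum.\<close>

lemma diag_sum_Suc: "diag_sum (Suc n) X Y = (X + Y) * diag_sum n X Y + 2 * offdiag_sum n X Y"
proof -
  have "Y * diag_sum n X Y = (\<Sum>k\<le>n. (real (n choose k))\<^sup>2 * X ^ k * Y ^ (Suc n - k))"
    unfolding diag_sum_def sum_distrib_left
    by (intro sum.cong refl) (simp add: Suc_diff_le)
  also have "\<dots> = (\<Sum>k\<le>Suc n. (real (n choose k))\<^sup>2 * X ^ k * Y ^ (Suc n - k))"
    by simp
  also have "\<dots> = Y ^ Suc n + (\<Sum>k\<le>n. (real (n choose Suc k))\<^sup>2 * X ^ Suc k * Y ^ (n - k))"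
    by (subst sum.atMost_Suc_shift) simp
  finally have Y: "Y * diag_sum n X Y = \<dots>" .
  have "diag_sum (Suc n) X Y
      = Y ^ Suc n + (\<Sum>k\<le>n. (real (Suc n choose Suc k))\<^sup>2 * X ^ Suc k * Y ^ (n - k))"
    unfolding diag_sum_def by (subst sum.atMost_Suc_shift) simp
  also have "(\<Sum>k\<le>n. (real (Suc n choose Suc k))\<^sup>2 * X ^ Suc k * Y ^ (n - k))
      = X * diag_sum n X Y + 2 * offdiag_sum n X Y
        + (\<Sum>k\<le>n. (real (n choose Suc k))\<^sup>2 * X ^ Suc k * Y ^ (n - k))"
    unfolding diag_sum_def offdiag_sum_def sum_distrib_left sum.distrib[symmetric]
    by (intro sum.cong refl) (simp add: power2_eq_square algebra_simps)
  finally show ?thesis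
    using Y by (simp add: distrib_right)
qed

text \<open>The weights \<open>n + 2\<close> and \<open>n + 1\<close> come from absorption: in \<open>C(n+1,k) C(n+1,k+1)\<close> the left
  factor is raised to \<open>C(n+2,k+1)\<close> and the right one lowered to \<open>C(n,k)\<close>. Expanding \<open>C(n+2,k+1)\<close>
  by Pascal's rule twice then leaves twice a square and two neighbouring products.\<close>

lemma offdiag_sum_Suc:
  "real (n + 2) * offdiag_sum (Suc n) X Y
     = real (n + 1) * (2 * (X * Y) * diag_sum n X Y + (X + Y) * offdiag_sum n X Y)"
proof -
  \<comment> \<open>\<open>C(n, k - 1)\<close> with the value \<open>0\<close> at \<open>k = 0\<close>, which truncated subtraction would make \<open>1\<close>\<close>
  define prev where "prev k = (if k = 0 then 0 else real (n choose (k - 1)))" for k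
  have coeff: "real (n + 2) * (real (Suc n choose k) * real (Suc n choose Suc k))
      = real (n + 1) * (real (n choose k) * (2 * real (n choose k) + real (n choose Suc k) + prev k))" for k
  proof -
    have 1: "real (n + 2) * real (Suc n choose k) = real (Suc k) * real (Suc (Suc n) choose Suc k)"
      using Suc_times_binomial_eq[of "Suc n" k] unfolding of_nat_mult[symmetric]
      by (simp add: mult.commute)
    have 2: "real (Suc k) * real (Suc n choose Suc k) = real (n + 1) * real (n choose k)"
      using Suc_times_binomial_eq[of n k] unfolding of_nat_mult[symmetric]
      by (simp add: mult.commute)
    have 3: "real (Suc (Suc n) choose Suc k) = 2 * real (n choose k) + real (n choose Suc k) + prev k"
      by (cases k) (simp_all add: prev_def)
    show ?thesis
      using 1 2 unfolding 3[symmetric] by (metis mult.assoc mult.commute)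
  qed
  have X: "X * offdiag_sum n X Y = (\<Sum>k\<le>n. real (n choose k) * prev k * X ^ Suc k * Y ^ (Suc n - k))"
  proof -
    have "(\<Sum>k\<le>n. real (n choose k) * prev k * X ^ Suc k * Y ^ (Suc n - k))
        = (\<Sum>k\<le>Suc n. real (n choose k) * prev k * X ^ Suc k * Y ^ (Suc n - k))"
      by simp
    also have "\<dots> = X * offdiag_sum n X Y"
      unfolding offdiag_sum_def sum_distrib_left
      by (subst sum.atMost_Suc_shift) (simp add: prev_def mult_ac)
    finally show ?thesis ..
  qed
  have "real (n + 2) * offdiag_sum (Suc n) X Y
      = (\<Sum>k\<le>n. real (n + 2) * (real (Suc n choose k) * real (Suc n choose Suc k)) * X ^ Suc k * Y ^ (Suc n - k))"
    unfolding offdiag_sum_def sum_distrib_left by (simp add: binomial_eq_0 mult_ac)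
  also have "\<dots> = (\<Sum>k\<le>n. real (n + 1) * (2 * (X * Y) * ((real (n choose k))\<^sup>2 * X ^ k * Y ^ (n - k))
      + Y * (real (n choose k) * real (n choose Suc k) * X ^ Suc k * Y ^ (n - k))
      + real (n choose k) * prev k * X ^ Suc k * Y ^ (Suc n - k)))"
    unfolding coeff
    by (intro sum.cong refl) (simp add: Suc_diff_le power2_eq_square algebra_simps)
  also have "\<dots> = real (n + 1) * (2 * (X * Y) * diag_sum n X Y + Y * offdiag_sum n X Y + X * offdiag_sum n X Y)"
    unfolding X unfolding diag_sum_def offdiag_sum_def sum_distrib_left sum.distrib[symmetric] ..
  finally show ?thesis
    by (simp add: algebra_simps)
qed

section \<open>Quadratic bounds for the ratio of the two sums\<close>

lemma diag_sum_pos: "0 < X \<Longrightarrow> 0 < Y \<Longrightarrow> 0 < diag_sum n X Y"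
  unfolding diag_sum_def by (intro sum_pos) auto

lemma offdiag_sum_nonneg: "0 \<le> X \<Longrightarrow> 0 \<le> Y \<Longrightarrow> 0 \<le> offdiag_sum n X Y"
  unfolding offdiag_sum_def by (intro sum_nonneg) auto

lemma diag_sum_0 [simp]: "diag_sum 0 X Y = 1"
  by (simp add: diag_sum_def)

lemma offdiag_sum_0 [simp]: "offdiag_sum 0 X Y = 0"
  by (simp add: offdiag_sum_def)

text \<open>Substituting the recurrences into \<open>gap\<close> produces a multiple of \<open>(X - Y)\<^sup>2\<close>, because for
  \<open>X = Y\<close> the ratio is exactly \<open>n X / (n + 1)\<close> and the gap vanishes identically. The other factor is
  the previous gap plus twice the Turan-type difference \<open>X Y D\<^sup>2 - E\<^sup>2\<close>, which is positive as soon as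
  the previous gap is nonnegative; hence the induction closes, with strictness after one step.\<close>

lemma offdiag_sum_upper:
  fixes X Y :: real
  assumes "0 < X" "0 < Y"
  defines "D \<equiv> \<lambda>n. diag_sum n X Y" and "E \<equiv> \<lambda>n. offdiag_sum n X Y"
  defines "gap \<equiv> \<lambda>n. 2 * real n * (X * Y) * (D n)\<^sup>2 - 2 * real (n + 1) * (E n)\<^sup>2 - (X + Y) * D n * E n"
  shows "0 \<le> gap n" and "X \<noteq> Y \<Longrightarrow> 0 < gap (Suc n)"
proof -
  have step: "real (n + 2) * gap (Suc n)
      = real (n + 1) * (X - Y)\<^sup>2 * (gap n + 2 * (X * Y * (D n)\<^sup>2 - (E n)\<^sup>2))" for n
  proof -
    define F where "F = 2 * (X * Y) * D n + (X + Y) * E n"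
    have D: "D (Suc n) = (X + Y) * D n + 2 * E n"
      unfolding D_def E_def by (rule diag_sum_Suc)
    have E: "real (n + 2) * E (Suc n) = real (n + 1) * F"
      unfolding F_def D_def E_def by (rule offdiag_sum_Suc)
    \<comment> \<open>one factor \<open>n + 2\<close> more than in the claim, to clear both denominators in \<open>E (Suc n)\<^sup>2\<close>\<close>
    have "real (n + 2) * (real (n + 2) * gap (Suc n))
        = 2 * real (n + 1) * (X * Y) * (real (n + 2))\<^sup>2 * (D (Suc n))\<^sup>2
          - 2 * real (n + 2) * (real (n + 2) * E (Suc n))\<^sup>2
          - (X + Y) * D (Suc n) * real (n + 2) * (real (n + 2) * E (Suc n))"
      by (simp add: gap_def power2_eq_square algebra_simps)
    also have "\<dots> = real (n + 2) * (real (n + 1) * (X - Y)\<^sup>2 * (gap n + 2 * (X * Y * (D n)\<^sup>2 - (E n)\<^sup>2)))"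
      unfolding E unfolding D F_def gap_def of_nat_add of_nat_1 of_nat_numeral by algebra
    finally show ?thesis by simp
  qed
  have turan: "0 < X * Y * (D n)\<^sup>2 - (E n)\<^sup>2" if "0 \<le> gap n" for n
  proof -
    have "0 \<le> (X + Y) * D n * E n" and pos: "0 < X * Y * (D n)\<^sup>2"
      using assms diag_sum_pos[of X Y n] offdiag_sum_nonneg[of X Y n] by (auto simp: D_def E_def)
    then have "real (n + 1) * (E n)\<^sup>2 \<le> real n * (X * Y * (D n)\<^sup>2)"
      using that by (simp add: gap_def algebra_simps)
    also have "\<dots> < real (n + 1) * (X * Y * (D n)\<^sup>2)"
      using pos by (intro mult_strict_right_mono) auto
    finally show ?thesis
      by (simp add: mult_less_cancel_left_pos)
  qed
  show nonneg: "0 \<le> gap n" for n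
  proof (induction n)
    case (Suc n)
    then have "0 \<le> real (n + 2) * gap (Suc n)"
      using turan[OF Suc] unfolding step by simp
    then show ?case by (simp add: zero_le_mult_iff)
  qed (simp add: gap_def D_def E_def)
  show "0 < gap (Suc n)" if "X \<noteq> Y"
  proof -
    have "0 < real (n + 2) * gap (Suc n)"
      unfolding step using nonneg[of n] turan[OF nonneg[of n]] that
      by (intro mult_pos_pos) auto
    then show ?thesis by (simp add: zero_less_mult_iff)
  qed
qed

text \<open>The same induction with \<open>M = max X Y\<close> in place of the mean \<open>(X + Y) / 2\<close>. With
  \<open>L = min X Y\<close> one has \<open>X + Y = M + L\<close> and \<open>X Y = M L\<close>, so the recurrences can be written in \<open>M\<close>
  and \<open>L\<close>; substituting them leaves \<open>M - L\<close> times a sum of nonnegative terms.\<close>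

lemma offdiag_sum_lower:
  fixes X Y :: real
  assumes "0 < X" "0 < Y"
  defines "D \<equiv> \<lambda>n. diag_sum n X Y" and "E \<equiv> \<lambda>n. offdiag_sum n X Y"
  shows "real n * (X * Y) * (D n)\<^sup>2 \<le> real (n + 1) * (E n)\<^sup>2 + max X Y * D n * E n"
proof -
  define M L where "M = max X Y" and "L = min X Y"
  have sum: "X + Y = M + L" and prod: "X * Y = M * L" and ord: "0 < L" "L \<le> M"
    using assms by (auto simp: M_def L_def max_def min_def)
  define gap where "gap n = real (n + 1) * (E n)\<^sup>2 + M * D n * E n - real n * (M * L) * (D n)\<^sup>2" for n
  have step: "real (n + 2) * gap (Suc n)
      = real (n + 1) * (M - L) * (2 * (L * D n + E n) * (M * (L * D n + E n)) + (M - L) * gap n)" for n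
  proof -
    define F where "F = 2 * (M * L) * D n + (M + L) * E n"
    have D: "D (Suc n) = (M + L) * D n + 2 * E n"
      unfolding D_def E_def sum[symmetric] by (rule diag_sum_Suc)
    have E: "real (n + 2) * E (Suc n) = real (n + 1) * F"
      unfolding F_def D_def E_def sum[symmetric] prod[symmetric] by (rule offdiag_sum_Suc)
    have "real (n + 2) * (real (n + 2) * gap (Suc n))
        = real (n + 2) * (real (n + 2) * E (Suc n))\<^sup>2
          + M * D (Suc n) * real (n + 2) * (real (n + 2) * E (Suc n))
          - real (n + 1) * (M * L) * (real (n + 2))\<^sup>2 * (D (Suc n))\<^sup>2"
      by (simp add: gap_def power2_eq_square algebra_simps)
    also have "\<dots> = real (n + 2) * (real (n + 1) * (M - L)
        * (2 * (L * D n + E n) * (M * (L * D n + E n)) + (M - L) * gap n))"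
      unfolding E unfolding D F_def gap_def of_nat_add of_nat_1 of_nat_numeral by algebra
    finally show ?thesis by simp
  qed
  have "0 \<le> gap n"
  proof (induction n)
    case (Suc n)
    have "0 \<le> D n" "0 \<le> E n"
      using assms diag_sum_pos[of X Y n] offdiag_sum_nonneg[of X Y n] by (auto simp: D_def E_def)
    then have "0 \<le> real (n + 2) * gap (Suc n)"
      unfolding step using ord Suc by (intro mult_nonneg_nonneg add_nonneg_nonneg) auto
    then show ?case by (simp add: zero_le_mult_iff)
  qed (simp add: gap_def E_def)
  then show ?thesis
    by (simp add: gap_def prod M_def)
qed

section \<open>Where the winning probability rises and falls\<close>

text \<open>If the step did not increase, the ratio would be at least \<open>a = q (1 - p)\<close>. But the
  quadratic of \<open>offdiag_sum_upper\<close>, evaluated at \<open>a\<close>, exceeds its bound by a positive multiple of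
  \<open>1 - (2n + 1) (p - q)\<close>, because \<open>2 a + X + Y = q + (1 - p)\<close>. In the boundary case
  \<open>(2n + 1) (p - q) = 1\<close> the contradiction comes from the strictness for \<open>X \<noteq> Y\<close>.\<close>

lemma win_prob_less_Suc:
  fixes p q :: real
  assumes "0 < q" "q < p" "p < 1"
    and n: "real (2 * n + 1) * (p - q) < 1 \<or> p + q \<noteq> 1 \<and> real (2 * n + 1) * (p - q) \<le> 1"
  shows "win_prob n p q < win_prob (Suc n) p q"
proof (rule ccontr)
  define X Y a where "X = p * q" and "Y = (1 - p) * (1 - q)" and "a = q * (1 - p)"
  define D E where "D = diag_sum n X Y" and "E = offdiag_sum n X Y"
  have pos: "0 < X" "0 < Y" "0 < a"
    using assms by (auto simp: X_def Y_def a_def)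
  then have D: "0 < D" by (simp add: D_def diag_sum_pos)
  assume "\<not> ?thesis"
  then have E: "a * D \<le> E"
    using win_prob_Suc_diff[of n p q] by (simp add: X_def Y_def a_def D_def E_def)
  have aE: "(a * D)\<^sup>2 \<le> E\<^sup>2"
    using E D pos by (intro power_mono) auto
  have "2 * real (n + 1) * (a * D)\<^sup>2 + (X + Y) * D * (a * D)
      \<le> 2 * real (n + 1) * E\<^sup>2 + (X + Y) * D * E"
    using E aE D pos by (intro add_mono mult_left_mono) auto
  moreover have "a * D\<^sup>2 * (1 - real (2 * n + 1) * (p - q))
      = 2 * real (n + 1) * (a * D)\<^sup>2 + (X + Y) * D * (a * D) - 2 * real n * (X * Y) * D\<^sup>2"
    unfolding X_def Y_def a_def of_nat_add of_nat_mult of_nat_1 of_nat_numeral by algebra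
  ultimately have key: "a * D\<^sup>2 * (1 - real (2 * n + 1) * (p - q))
      \<le> - (2 * real n * (X * Y) * D\<^sup>2 - 2 * real (n + 1) * E\<^sup>2 - (X + Y) * D * E)"
    by linarith
  have aD: "0 < a * D\<^sup>2" using pos D by simp
  show False
  proof (cases "real (2 * n + 1) * (p - q) < 1")
    case True
    then have "0 < a * D\<^sup>2 * (1 - real (2 * n + 1) * (p - q))"
      by (intro mult_pos_pos[OF aD]) simp
    then show False
      using key offdiag_sum_upper(1)[OF pos(1,2), of n] by (simp add: D_def E_def)
  next
    case False
    with n have pq: "p + q \<noteq> 1" and eq: "real (2 * n + 1) * (p - q) = 1" by auto
    have "n \<noteq> 0" by (rule notI) (use eq assms in simp)
    then obtain k where k: "n = Suc k" by (cases n) auto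
    have "X \<noteq> Y" using pq by (simp add: X_def Y_def algebra_simps)
    then show False
      using key offdiag_sum_upper(2)[OF pos(1,2), of k] unfolding eq by (simp add: D_def E_def k)
  qed
qed

text \<open>An increasing step means a ratio below \<open>a = q (1 - p)\<close>. Since \<open>a + X = q\<close> and
  \<open>a + Y = 1 - p\<close>, \<open>offdiag_sum_lower\<close> then forces \<open>n (p - q) < max (1 - p) q\<close>.\<close>

lemma win_prob_Suc_le:
  fixes p q :: real
  assumes "0 < q" "q < p" "p < 1"
    and n: "max (1 - p) q \<le> real n * (p - q)"
  shows "win_prob (Suc n) p q \<le> win_prob n p q"
proof (rule ccontr)
  define X Y a where "X = p * q" and "Y = (1 - p) * (1 - q)" and "a = q * (1 - p)"
  define D E where "D = diag_sum n X Y" and "E = offdiag_sum n X Y"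
  have pos: "0 < X" "0 < Y" "0 < a"
    using assms by (auto simp: X_def Y_def a_def)
  then have D: "0 < D" and E0: "0 \<le> E"
    by (simp_all add: D_def E_def diag_sum_pos offdiag_sum_nonneg)
  assume "\<not> ?thesis"
  then have E: "E < a * D"
    using win_prob_Suc_diff[of n p q] by (simp add: X_def Y_def a_def D_def E_def)
  have "E\<^sup>2 \<le> (a * D)\<^sup>2"
    using E E0 by (intro power_mono) auto
  then have "real (n + 1) * E\<^sup>2 + max X Y * D * E < real (n + 1) * (a * D)\<^sup>2 + max X Y * D * (a * D)"
    using E D pos by (intro add_le_less_mono mult_left_mono mult_strict_left_mono) auto
  with offdiag_sum_lower[OF pos(1,2), of n]
  have "real n * (X * Y) * D\<^sup>2 < real (n + 1) * (a * D)\<^sup>2 + max X Y * D * (a * D)"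
    by (simp add: D_def E_def)
  moreover have "real (n + 1) * (a * D)\<^sup>2 + max X Y * D * (a * D) - real n * (X * Y) * D\<^sup>2
      = a * D\<^sup>2 * (a + max X Y - real n * (p - q))"
    unfolding a_def of_nat_add of_nat_1 
    by (simp add: X_def Y_def power2_eq_square algebra_simps)
  ultimately have "0 < a * D\<^sup>2 * (a + max X Y - real n * (p - q))"
    by linarith
  moreover have "0 < a * D\<^sup>2"
    using pos D by simp
  ultimately have "real n * (p - q) < a + max X Y"
    using zero_less_mult_pos by fastforce
  also have "a + max X Y = max (1 - p) q"
    by (simp add: a_def X_def Y_def max_def algebra_simps)
  finally show False using n by simp
qed

section \<open>Bounds on the optimal number of tosses\<close>

text \<open>From \<open>K\<close> on, where \<open>K\<close> is the claimed upper bound, the sequence does not increase; so a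
  maximum over \<open>{..K}\<close> is a global one and the least maximizer is at most \<open>K\<close>. For the lower
  bounds a single step suffices: at a maximizer the next step does not increase.\<close>

theorem theorem3:
  fixes p q :: real
  assumes "0 < q" and "q < p" and "p < 1"
  shows "\<lfloor>1 / (2 * (p - q)) - 1 / 2\<rfloor> \<le> int (best_n q p)
       \<and> (p + q \<noteq> 1 \<longrightarrow> \<lfloor>1 / (2 * (p - q)) + 1 / 2\<rfloor> \<le> int (best_n q p))
       \<and> int (best_n q p) \<le> \<lceil>max (1 - p) q / (p - q)\<rceil>"
proof -
  let ?f = "\<lambda>n. win_prob n p q"
  let ?maximal = "\<lambda>n. \<forall>m. ?f m \<le> ?f n"
  have d: "0 < p - q" using assms by simp
  define K where "K = nat \<lceil>max (1 - p) q / (p - q)\<rceil>"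
  have K_int: "int K = \<lceil>max (1 - p) q / (p - q)\<rceil>"
  proof -
    have "0 \<le> max (1 - p) q / (p - q)" using assms by simp
    then show ?thesis unfolding K_def by linarith
  qed
  then have K: "max (1 - p) q \<le> real K * (p - q)"
    using d by (metis le_of_int_ceiling of_int_of_nat_eq pos_divide_le_eq)
  have desc: "?f (Suc n) \<le> ?f n" if "K \<le> n" for n
  proof -
    have "real K * (p - q) \<le> real n * (p - q)"
      using that d by (intro mult_right_mono) auto
    then show ?thesis
      using win_prob_Suc_le[OF assms, of n] K by linarith
  qed
  have tail: "?f m \<le> ?f K" if "K \<le> m" for m
    using that by (induction m rule: dec_induct) (auto intro: order_trans[OF desc])
  have "\<exists>n\<le>K. \<forall>m\<le>K. ?f m \<le> ?f n"
    using finite_imageI[of "{..K}" ?f] Max_in[of "?f ` {..K}"] Max_ge[of "?f ` {..K}"]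
    by fastforce
  then obtain n where n: "n \<le> K" "\<And>m. m \<le> K \<Longrightarrow> ?f m \<le> ?f n" by blast
  have max_n: "?maximal n"
    using n tail by (meson nle_le order_trans)
  have best_le: "best_n q p \<le> K"
    unfolding best_n_def using Least_le[of ?maximal, OF max_n] n(1) by linarith
  have best_max: "?f m \<le> ?f (best_n q p)" for m
    unfolding best_n_def using LeastI[of ?maximal, OF max_n] by blast
  have slope: "real (2 * best_n q p + 1) * (p - q) \<ge> 1"
      "p + q \<noteq> 1 \<Longrightarrow> real (2 * best_n q p + 1) * (p - q) > 1"
    using win_prob_less_Suc[OF assms, of "best_n q p"] best_max[of "Suc (best_n q p)"] by force+
  have 1: "\<lfloor>1 / (2 * (p - q)) - 1 / 2\<rfloor> \<le> int (best_n q p)"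
  proof -
    have "1 / (2 * (p - q)) - 1 / 2 \<le> real (best_n q p)"
      using slope(1) d by (simp add: field_simps)
    then show ?thesis by linarith
  qed
  have 2: "\<lfloor>1 / (2 * (p - q)) + 1 / 2\<rfloor> \<le> int (best_n q p)" if "p + q \<noteq> 1"
  proof -
    have "1 / (2 * (p - q)) + 1 / 2 < real (best_n q p) + 1"
      using slope(2)[OF that] d by (simp add: field_simps)
    then show ?thesis by linarith
  qed
  show ?thesis
    using 1 2 best_le K_int by simp
qed

end
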